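(* Let $X$, $d$, $\mu$, $\mathcal{S}$ and the subdivision algorithm be as described in the context, with constants $0<\varepsilon_1,\varepsilon_2<1$ such that every subdivision of a region $J$ into $J_1,\dots,J_k$ performed by the algorithm satisfies $\mu(J_j)\ge\varepsilon_1\mu(J)$ and $\operatorname{Diam}(J_j)\le\varepsilon_2\operatorname{Diam}(J)$ for all $j$. Suppose that the stopping criteria $C_1,\dots,C_\ell$ used by the algorithm are all diameter-distance tests, with associated positive constants $K_i$ and closed subsets $V_i\subseteq X$. Furthermore, assume that the intersection $\bigcap_{i=1}^\ell V_i$ is empty. Let $K=\min_i K_i$, let $I\in\mathcal{S}$ be the initial input region, and let the separation bound $\delta$ be a real number with $$0<\delta\le\min_{x\in I}\max_{1\le i\le\ell} d(x,V_i).$$ Then the number of regions constructed by the algorithm is at most $$\max\left\{1,\ \varepsilon_1^{-1+\frac{\ln\operatorname{Diam}(I)-\ln(K\delta)}{\ln(\varepsilon_2)}}\right\}.$$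
   Context: Setting: $X$ is a measure space with measure $\mu$ and also a metric space with distance $d$ (no compatibility between $\mu$ and $d$ is required); $X$ is proper, i.e. closed balls are compact. $\mathcal{S}$ is a collection of subsets of $X$ that have finite $\mu$-measure and are compact. A stopping criterion is a function $C:\mathcal{S}\to\{\text{True},\text{False}\}$. $\operatorname{Diam}$ denotes the diameter with respect to $d$. Diameter-distance test: a stopping criterion $C$ is a diameter-distance test if there exist a closed set $V\subseteq X$ and a positive constant $K$ such that for every $J\in\mathcal{S}$: if $\operatorname{Diam}(J)<K\max_{x\in J}d(x,V)$, then $C(J)=\text{True}$; here $d(x,V)=\min_{v\in V}d(x,v)$. Algorithm: fix stopping criteria $C_1,\dots,C_\ell$ and an input region $I\in\mathcal{S}$. Start with $P=\{I\}$. As long as some $J\in P$ has $C_i(J)=\text{False}$ for all $i$, subdivide $J$, i.e. replace $J$ in $P$ by regions $J_1,\dots,J_k\in\mathcal{S}$ ($k\ge2$) with $J=\bigcup_j J_j$ and with pairwise intersections of $\mu$-measure zero. Regions $J$ with $C_i(J)=\text{True}$ for some $i$ are not subdivided. The regions constructed by the algorithm are the (terminal) elements of the final $P$.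
   Formalization: The initial region I is additionally assumed to have positive measure μ(I) > 0; if μ(I) = 0, the condition μ(J_j) ≥ ε₁μ(J) is vacuous and the bound can fail (e.g. μ = 0 and one subdivision into 1000 pieces with ε₁ = 0.9). *)

theory Defs
  imports "HOL-Analysis.Analysis"
begin

(* The library's infdist x {} is 0; as an extended real the infimum over the
   empty set is infinity. For a nonempty closed V in a proper space the infimum
   is a minimum and the value agrees with infdist x V. *)
definition point_set_dist :: "'a::metric_space \<Rightarrow> 'a set \<Rightarrow> ereal" where
  "point_set_dist x V = (INF v\<in>V. ereal (dist x v))"

(* For nonempty compact J the supremum is attained. *)
definition diameter_distance_test ::
  "'a::metric_space set set \<Rightarrow> ('a set \<Rightarrow> bool) \<Rightarrow> 'a set \<Rightarrow> real \<Rightarrow> bool" where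
  "diameter_distance_test \<S> C V K \<longleftrightarrow>
     closed V \<and> K > 0 \<and>
     (\<forall>J\<in>\<S>. ereal (diameter J) < ereal K * (SUP x\<in>J. point_set_dist x V) \<longrightarrow> C J)"

definition subdivision ::
  "'a measure \<Rightarrow> 'a set set \<Rightarrow> 'a set \<Rightarrow> 'a set list \<Rightarrow> bool" where
  "subdivision M \<S> J Js \<longleftrightarrow>
     length Js \<ge> 2 \<and> set Js \<subseteq> \<S> \<and> J = \<Union>(set Js) \<and>
     (\<forall>i<length Js. \<forall>j<length Js. i \<noteq> j \<longrightarrow> Js ! i \<inter> Js ! j \<in> null_sets M)"

definition undecided :: "nat \<Rightarrow> (nat \<Rightarrow> 'a set \<Rightarrow> bool) \<Rightarrow> 'a set \<Rightarrow> bool" where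
  "undecided l C J \<longleftrightarrow> (\<forall>i\<in>{1..l}. \<not> C i J)"

definition finished :: "nat \<Rightarrow> (nat \<Rightarrow> 'a set \<Rightarrow> bool) \<Rightarrow> 'a set set \<Rightarrow> bool" where
  "finished l C P \<longleftrightarrow> (\<forall>J\<in>P. \<not> undecided l C J)"

(* A run from I, as an infinite sequence: P n is the partition after n steps.
   While P n is not finished, the region J n is replaced by the list Js n;
   once P n is finished the sequence stays constant, and J n, Js n are
   irrelevant. *)
definition subdivision_run ::
  "'a measure \<Rightarrow> 'a set set \<Rightarrow> nat \<Rightarrow> (nat \<Rightarrow> 'a set \<Rightarrow> bool) \<Rightarrow> 'a set \<Rightarrow>
   (nat \<Rightarrow> 'a set set) \<Rightarrow> (nat \<Rightarrow> 'a set) \<Rightarrow> (nat \<Rightarrow> 'a set list) \<Rightarrow> bool" where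
  "subdivision_run M \<S> l C I P J Js \<longleftrightarrow>
     P 0 = {I} \<and>
     (\<forall>n. if finished l C (P n) then P (Suc n) = P n
          else J n \<in> P n \<and> undecided l C (J n) \<and> subdivision M \<S> (J n) (Js n) \<and>
               P (Suc n) = (P n - {J n}) \<union> set (Js n))"

end

theory Submission
  imports Defs
begin

text \<open>
  A region inside \<open>I\<close> that is still undecided has diameter at least \<open>K \<delta>\<close>: at any of its points
  some \<open>V i\<close> is at distance at least \<open>\<delta>\<close>, so otherwise the \<open>i\<close>-th test would accept it. Hence a region
  at depth \<open>k + 1\<close> has a parent with \<open>K \<delta> \<le> \<epsilon>2 ^ k * diameter I\<close>, which bounds \<open>k\<close> and bounds the
  measure of every region that ever occurs from below by a fixed multiple of the measure of \<open>I\<close>. The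
  regions present at any time overlap only in null sets, so the sum of their measures is at most
  that of \<open>I\<close>, and this bounds their number. Every subdivision increases the number, so the run
  ends.
\<close>

text \<open>In the induction the new set meets the union of the others in a finite union of null
  sets, so the correction term of inclusion-exclusion vanishes.\<close>

lemma measure_Union_null_inter:
  assumes "finite P" "P \<subseteq> fmeasurable M" "pairwise (\<lambda>A B. A \<inter> B \<in> null_sets M) P"
  shows "measure M (\<Union>P) = (\<Sum>A\<in>P. measure M A)"
  using assms
proof (induction P rule: finite_induct)
  case (insert A P)
  have "(\<Union>B\<in>P. A \<inter> B) \<in> null_sets M"
    using insert.hyps insert.prems by (intro null_sets.finite_UN) (auto simp: pairwise_insert)
  moreover have "A \<inter> \<Union>P = (\<Union>B\<in>P. A \<inter> B)" by (rule Int_Union)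
  ultimately have "measure M (A \<inter> \<Union>P) = 0" by (metis measure_eq_0_null_sets)
  moreover have "\<Union>P \<in> fmeasurable M"
    using insert.hyps insert.prems by (intro fmeasurable.finite_Union) auto
  ultimately have "measure M (A \<union> \<Union>P) = measure M A + measure M (\<Union>P)"
    using insert.prems by (simp add: measure_Un3)
  then show ?case using insert by (simp add: pairwise_insert)
qed simp

lemma undecided_diameter_ge:
  assumes tests: "\<And>i. i \<in> {1..l} \<Longrightarrow> diameter_distance_test \<S> (C i) (V i) (K i)"
    and l: "l \<ge> 1"
    and \<delta>: "0 < \<delta>" "ereal \<delta> \<le> (INF x\<in>I. MAX i\<in>{1..l}. point_set_dist x (V i))"
    and A: "A \<in> \<S>" "A \<subseteq> I" "A \<noteq> {}" "undecided l C A"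
  shows "(MIN i\<in>{1..l}. K i) * \<delta> \<le> diameter A"
proof -
  obtain x where x: "x \<in> A" using A by blast
  have "ereal \<delta> \<le> (MAX i\<in>{1..l}. point_set_dist x (V i))"
    using \<delta>(2) x A(2) by (auto simp: le_INF_iff)
  then obtain i where i: "i \<in> {1..l}" "ereal \<delta> \<le> point_set_dist x (V i)"
    using l by (subst (asm) Max_ge_iff) auto
  have K: "K i > 0" and "\<not> C i A"
    using tests[OF i(1)] A(4) i(1) by (auto simp: diameter_distance_test_def undecided_def)
  then have "ereal (K i) * (SUP x\<in>A. point_set_dist x (V i)) \<le> ereal (diameter A)"
    using tests[OF i(1)] A(1) by (auto simp: diameter_distance_test_def not_less[symmetric])
  \<comment> \<open>If \<open>V i\<close> is empty this supremum is infinite, so the comparison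
    stays in \<open>ereal\<close> until transitivity eliminates the supremum.\<close>
  moreover have "ereal \<delta> \<le> (SUP x\<in>A. point_set_dist x (V i))"
    using i(2) x by (meson SUP_upper order_trans)
  then have "ereal (K i) * ereal \<delta> \<le> ereal (K i) * (SUP x\<in>A. point_set_dist x (V i))"
    using K by (intro ereal_mult_left_mono) auto
  ultimately have "K i * \<delta> \<le> diameter A"
    using order_trans by fastforce
  moreover have "(MIN i\<in>{1..l}. K i) \<le> K i" using i(1) by auto
  ultimately show ?thesis
    using \<delta>(1) by (meson mult_right_mono order_less_imp_le order_trans)
qed

text \<open>Turns the diameter bound on a parent at depth \<open>k\<close> into a measure bound for
  its child at depth \<open>Suc k\<close>. Taking logarithms and dividing by the negative number
  \<open>ln \<epsilon>2\<close> bounds \<open>k\<close> from above; since \<epsilon>1 < 1, the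
  larger exponent gives the smaller power.\<close>

lemma powr_le_power_depth:
  fixes \<epsilon>1 \<epsilon>2 D s :: real
  assumes "0 < \<epsilon>1" "\<epsilon>1 < 1" "0 < \<epsilon>2" "\<epsilon>2 < 1" "0 < s" and le: "s \<le> \<epsilon>2 ^ k * D"
  shows "\<epsilon>1 powr (1 - (ln D - ln s) / ln \<epsilon>2) \<le> \<epsilon>1 ^ Suc k"
proof -
  have D: "D > 0"
    using assms by (smt (verit) mult_nonneg_nonpos zero_le_power)
  have "ln s \<le> ln (\<epsilon>2 ^ k * D)" using le assms by simp
  also have "\<dots> = real k * ln \<epsilon>2 + ln D" using assms D by (simp add: ln_mult ln_realpow)
  finally have "real k \<le> - ((ln D - ln s) / ln \<epsilon>2)"
    using assms by (simp add: field_simps)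
  then have "\<epsilon>1 powr (1 - (ln D - ln s) / ln \<epsilon>2) \<le> \<epsilon>1 powr real (Suc k)"
    using assms by (intro powr_mono') auto
  then show ?thesis using assms(1) by (simp only: powr_realpow)
qed

text \<open>Replacing \<open>J\<close> in a set rather than a multiset could merge equal regions.
  Positive measure excludes this: two equal regions would intersect in themselves, which is not a
  null set. Hence exactly \<open>length Js - 1\<close> regions are gained.\<close>

lemma subdivision_step:
  assumes P: "finite P" "P \<subseteq> \<S>" "pairwise (\<lambda>A B. A \<inter> B \<in> null_sets M) P" "J \<in> P"
    and sub: "subdivision M \<S> J Js"
    and meas: "\<S> \<subseteq> sets M"
    and pos: "\<And>A. A \<in> set Js \<Longrightarrow> measure M A > 0"
  shows "pairwise (\<lambda>A B. A \<inter> B \<in> null_sets M) (P - {J} \<union> set Js)"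
    and "card P < card (P - {J} \<union> set Js)"
proof -
  have sets: "set Js \<subseteq> \<S>" and J: "J = \<Union>(set Js)" and len: "length Js \<ge> 2"
    and null: "\<And>i j. i < length Js \<Longrightarrow> j < length Js \<Longrightarrow> i \<noteq> j \<Longrightarrow> Js ! i \<inter> Js ! j \<in> null_sets M"
    using sub by (auto simp: subdivision_def)
  have outer: "A \<inter> B \<in> null_sets M" if "A \<in> set Js" "B \<in> P - {J}" for A B
  proof (rule null_sets_subset)
    show "J \<inter> B \<in> null_sets M" using P(3,4) that by (auto simp: pairwise_def)
    show "A \<inter> B \<in> sets M" using that sets meas P(2) by (intro sets.Int) auto
    show "A \<inter> B \<subseteq> J \<inter> B" using that J by blast
  qed
  have inner: "A \<inter> B \<in> null_sets M" if "A \<in> set Js" "B \<in> set Js" "A \<noteq> B" for A B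
    using that null by (metis in_set_conv_nth)
  show "pairwise (\<lambda>A B. A \<inter> B \<in> null_sets M) (P - {J} \<union> set Js)"
    unfolding pairwise_def using P(3) inner outer
    by (metis Diff_iff Int_commute Un_iff pairwise_def)
  have notnull: "A \<notin> null_sets M" if "A \<in> set Js" for A
    using pos[OF that] measure_eq_0_null_sets by fastforce
  have "distinct Js"
    unfolding distinct_conv_nth using null notnull by (metis inf.idem nth_mem)
  moreover have "(P - {J}) \<inter> set Js = {}"
    using outer notnull by (metis disjoint_iff inf.idem)
  ultimately have "card (P - {J} \<union> set Js) = card P - 1 + length Js"
    using P(1,4) by (simp add: card_Un_disjoint distinct_card)
  then show "card P < card (P - {J} \<union> set Js)" using len by linarith
qed

theorem proposition3:
  fixes M :: "'a::metric_space measure"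
    and \<S> :: "'a set set"
    and l :: nat
    and C :: "nat \<Rightarrow> 'a set \<Rightarrow> bool"
    and V :: "nat \<Rightarrow> 'a set"
    and K :: "nat \<Rightarrow> real"
    and I :: "'a set"
    and P :: "nat \<Rightarrow> 'a set set"
    and J :: "nat \<Rightarrow> 'a set"
    and Js :: "nat \<Rightarrow> 'a set list"
    and \<epsilon>1 \<epsilon>2 \<delta> :: real
  assumes space: "space M = UNIV"
    and proper: "\<And>(x::'a) r. compact (cball x r)"
    and regions: "\<And>A. A \<in> \<S> \<Longrightarrow> A \<in> fmeasurable M \<and> compact A"
    and eps1: "0 < \<epsilon>1" "\<epsilon>1 < 1"
    and eps2: "0 < \<epsilon>2" "\<epsilon>2 < 1"
    and tests: "\<And>i. i \<in> {1..l} \<Longrightarrow> diameter_distance_test \<S> (C i) (V i) (K i)"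
    and empty_Inter: "(\<Inter>i\<in>{1..l}. V i) = {}"
    and I_region: "I \<in> \<S>"
    and I_pos: "measure M I > 0"
    and run: "subdivision_run M \<S> l C I P J Js"
    and shrink: "\<And>n A. \<not> finished l C (P n) \<Longrightarrow> A \<in> set (Js n) \<Longrightarrow>
                   measure M A \<ge> \<epsilon>1 * measure M (J n) \<and>
                   diameter A \<le> \<epsilon>2 * diameter (J n)"
    and delta_pos: "0 < \<delta>"
    and delta_le: "ereal \<delta> \<le> (INF x\<in>I. MAX i\<in>{1..l}. point_set_dist x (V i))"
  shows "\<exists>N. finished l C (P N) \<and> finite (P N) \<and>
           real (card (P N)) \<le>
             max 1 (\<epsilon>1 powr (- 1 + (ln (diameter I) - ln ((MIN i\<in>{1..l}. K i) * \<delta>)) / ln \<epsilon>2))"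
proof -
  let ?s = "(MIN i\<in>{1..l}. K i) * \<delta>"
  let ?D = "diameter I"
  let ?c = "\<epsilon>1 powr (1 - (ln ?D - ln ?s) / ln \<epsilon>2)"
  let ?null = "\<lambda>A B. A \<inter> B \<in> null_sets M"
  \<comment> \<open>For \<open>l = 0\<close> the intersection would be the whole type, which is
    inhabited.\<close>
  have l: "l \<ge> 1" using empty_Inter by (cases "l = 0") auto
  have Kpos: "K i > 0" if "i \<in> {1..l}" for i
    using tests[OF that] by (simp add: diameter_distance_test_def)
  have "(MIN i\<in>{1..l}. K i) > 0" using l Kpos by (subst Min_gr_iff) auto
  then have s: "?s > 0" using delta_pos by simp
  have P0: "P 0 = {I}"
    and step: "\<not> finished l C (P n) \<Longrightarrow> J n \<in> P n \<and> undecided l C (J n) \<and>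
      subdivision M \<S> (J n) (Js n) \<and> P (Suc n) = P n - {J n} \<union> set (Js n)"
    and stay: "finished l C (P n) \<Longrightarrow> P (Suc n) = P n" for n
    using run by (auto simp: subdivision_run_def)
  have meas: "\<S> \<subseteq> sets M" using regions by (auto simp: fmeasurableD)
  have pos_nonempty: "A \<noteq> {}" if "measure M A > 0" for A :: "'a set" using that by auto
  have large: "?s \<le> diameter A" if "A \<in> \<S>" "A \<subseteq> I" "A \<noteq> {}" "undecided l C A" for A
    using undecided_diameter_ge[OF _ l delta_pos delta_le that] tests by blast
  show ?thesis
  \<comment> \<open>The cases match the two arguments of \<open>max\<close>. Either \<open>I\<close>
    is accepted at once and is the only region, or it is undecided and therefore large enough for
    the third conjunct of \<open>at_depth 0 I\<close>.\<close>
  proof (cases "finished l C (P 0)")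
    case True
    then show ?thesis by (intro exI[of _ 0]) (simp add: P0)
  next
    case False
    then have I_large: "?s \<le> ?D"
      using large[OF I_region order_refl pos_nonempty[OF I_pos]] by (auto simp: P0 finished_def)
    \<comment> \<open>\<open>k\<close> is the depth of \<open>A\<close> in the subdivision tree; \<open>k - 1\<close> truncates to \<open>0\<close> at the root.\<close>
    define at_depth where "at_depth k A \<longleftrightarrow> \<epsilon>1 ^ k * measure M I \<le> measure M A \<and>
      diameter A \<le> \<epsilon>2 ^ k * ?D \<and> ?s \<le> \<epsilon>2 ^ (k - 1) * ?D" for k A
    have pos: "measure M A > 0" if "at_depth k A" for k A
    proof -
      have "0 < \<epsilon>1 ^ k * measure M I" using eps1 I_pos by simp
      then show ?thesis using that unfolding at_depth_def by linarith
    qed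
    \<comment> \<open>Containment in \<open>I\<close> and null overlaps together keep the total
      measure at most that of \<open>I\<close>.\<close>
    define good where "good Q \<longleftrightarrow> finite Q \<and> Q \<subseteq> \<S> \<and> pairwise ?null Q \<and>
      (\<forall>A\<in>Q. A \<subseteq> I \<and> (\<exists>k. at_depth k A))" for Q
    have next_good: "good (P (Suc n)) \<and> card (P n) < card (P (Suc n))"
      if good: "good (P n)" and unfin: "\<not> finished l C (P n)" for n
    proof -
      note st = step[OF unfin]
      have J: "J n \<in> \<S>" "J n \<subseteq> I" using good st by (auto simp: good_def)
      obtain k where k: "at_depth k (J n)" using good st by (auto simp: good_def)
      have J_large: "?s \<le> diameter (J n)"
        using large[OF J(1,2) pos_nonempty[OF pos[OF k]]] st by blast
      \<comment> \<open>The third conjunct for the child comes from its undecided parent: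
        \<open>?s \<le> diameter (J n) \<le> \<epsilon>2 ^ k * ?D\<close>. The child itself may
        already be accepted.\<close>
      have child: "at_depth (Suc k) A" if A: "A \<in> set (Js n)" for A
      proof -
        have "\<epsilon>1 * (\<epsilon>1 ^ k * measure M I) \<le> \<epsilon>1 * measure M (J n)"
          using k eps1 by (intro mult_left_mono) (auto simp: at_depth_def)
        moreover have "\<epsilon>2 * diameter (J n) \<le> \<epsilon>2 * (\<epsilon>2 ^ k * ?D)"
          using k eps2 by (intro mult_left_mono) (auto simp: at_depth_def)
        ultimately show ?thesis
          using shrink[OF unfin A] k J_large by (auto simp: at_depth_def mult.assoc)
      qed
      have sub: "subdivision M \<S> (J n) (Js n)" using st by blast
      have nxt: "pairwise ?null (P (Suc n))" "card (P n) < card (P (Suc n))"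
        using subdivision_step[OF _ _ _ _ sub meas pos[OF child]] good st
        by (auto simp: good_def)
      moreover have "A \<in> \<S> \<and> A \<subseteq> I" if "A \<in> set (Js n)" for A
        using sub that J(2) by (auto simp: subdivision_def)
      ultimately show ?thesis using good st child by (auto simp: good_def)
    qed
    have "at_depth 0 I" using I_large by (simp add: at_depth_def)
    then have "good (P 0)" using I_region by (auto simp: good_def P0)
    then have good: "good (P n)" for n
    proof (induction n)
      case (Suc n)
      then show ?case using next_good[of n] stay[of n] by (cases "finished l C (P n)") simp_all
    qed simp
    have bound: "real (card (P n)) * ?c \<le> 1" for n
    proof -
      have fm: "P n \<subseteq> fmeasurable M" and fin: "finite (P n)"
        using good[of n] regions by (auto simp: good_def)
      have "?c * measure M I \<le> measure M A" if A: "A \<in> P n" for A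
      proof -
        obtain k where k: "at_depth k A" using good[of n] A by (auto simp: good_def)
        then have "?c \<le> \<epsilon>1 ^ Suc (k - 1)"
          using powr_le_power_depth eps1 eps2 s by (simp add: at_depth_def)
        \<comment> \<open>\<open>Suc (k - 1)\<close> equals \<open>k\<close> except at the root,
          where the step reads \<open>\<epsilon>1 \<le> 1\<close>.\<close>
        also have "\<dots> \<le> \<epsilon>1 ^ k" using eps1 by (intro power_decreasing) auto
        finally have "?c * measure M I \<le> \<epsilon>1 ^ k * measure M I"
          by (rule mult_right_mono) simp
        then show ?thesis using k by (auto simp: at_depth_def)
      qed
      then have "real (card (P n)) * (?c * measure M I) \<le> (\<Sum>A\<in>P n. measure M A)"
        by (rule sum_bounded_below)
      also have "\<dots> = measure M (\<Union>(P n))"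
        using measure_Union_null_inter[OF fin fm] good[of n] by (simp add: good_def)
      also have "\<dots> \<le> measure M I"
        using good[of n] I_region regions fin fm
        by (intro measure_mono_fmeasurable) (auto simp: good_def fmeasurableD)
      finally show ?thesis using I_pos by (simp flip: mult.assoc)
    qed
    have c: "?c > 0" using eps1 by simp
    \<comment> \<open>This holds at every stage, finished or not, so it also yields termination: in
      an endless run \<open>card (P n)\<close> would be at least \<open>n\<close>.\<close>
    have card_le: "real (card (P n)) \<le> \<epsilon>1 powr (- 1 + (ln ?D - ln ?s) / ln \<epsilon>2)" for n
    proof -
      have "\<epsilon>1 powr (- 1 + (ln ?D - ln ?s) / ln \<epsilon>2) = 1 / ?c"
        by (simp flip: powr_minus_divide)
      then show ?thesis using bound[of n] c by (simp add: pos_le_divide_eq)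
    qed
    have "\<exists>N. finished l C (P N)"
    proof (rule ccontr)
      assume "\<nexists>N. finished l C (P N)"
      then have "n \<le> card (P n)" for n
      proof (induction n)
        case (Suc n)
        then show ?case using next_good[OF good, of n] \<open>\<nexists>N. finished l C (P N)\<close> by fastforce
      qed simp
      moreover obtain m where "\<epsilon>1 powr (- 1 + (ln ?D - ln ?s) / ln \<epsilon>2) < real m"
        using reals_Archimedean2 by blast
      ultimately show False using card_le[of m] by (meson not_less of_nat_le_iff order_trans)
    qed
    then show ?thesis using card_le good by (auto simp: good_def le_max_iff_disj)
  qed
qed

end
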